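(* Let $G$ be a grid graph and let $f:\mathbb{Z}^2\to\mathbb{R}^2$, $f(x,y)=(x,y)$, be the natural labeling of $P_\infty\,\Box\,P_\infty$. Let $k\geq2$ be an integer. If $G$ contains $P_{2k-3}\,\Box\,P_{2k-3}$ as a subgraph and the restriction of $f$ to $V(G)$ is a $k$-monotone-geodesic labeling of $G$, then $\mathrm{gp}^k(G)=(k-1)^2$.
   Context: $P_\infty\,\Box\,P_\infty$ has vertex set $\mathbb{Z}^2$, with $(x,y)$ and $(x',y')$ adjacent iff they differ by exactly $1$ in exactly one coordinate. A grid graph is an induced connected subgraph of $P_\infty\,\Box\,P_\infty$. $P_m\,\Box\,P_m$ denotes the Cartesian product of two paths on $m$ vertices (the $m\times m$ grid). A geodesic of a graph is a shortest path between two of its vertices. For a graph $G$ and $k\ge2$, $\mathrm{gp}^k(G)$ is the largest cardinality of a set $S\subseteq V(G)$ such that no geodesic of $G$ contains $k$ or more vertices of $S$. A sequence of points $((x_1,y_1),\ldots,(x_k,y_k))$ in $\mathbb{R}^2$ is monotone if both coordinate sequences $(x_i)$ and $(y_i)$ are monotone (each nondecreasing or nonincreasing). An injective function $f:V(G)\to\mathbb{R}^2$ is a $k$-monotone-geodesic labeling of $G$ if whenever $v_1,\ldots,v_k\in V(G)$ and $(f(v_1),\ldots,f(v_k))$ is monotone, there is a geodesic $g$ of $G$ whose vertex set contains $v_1,\ldots,v_k$. *)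

theory Defs
  imports
    Complex_Main
    "HOL-Library.Extended_Nat"
    "Graph_Theory.Graph_Theory"
begin

text \<open>
  Simple graphs are symmetric pair digraphs; the coercion \<open>with_proj\<close> embeds them into the
  general digraphs of the library. Graphs may be infinite.
\<close>

definition path_graph :: "nat \<Rightarrow> nat pair_pre_digraph" where
  "path_graph n = \<lparr> pverts = {..<n},
     parcs = {(i, j). i < n \<and> j < n \<and> (j = Suc i \<or> i = Suc j)} \<rparr>"

definition path_inf :: "int pair_pre_digraph" where
  "path_inf = \<lparr> pverts = UNIV, parcs = {(x, y). \<bar>x - y\<bar> = 1} \<rparr>"

definition cart_prod :: "'a pair_pre_digraph \<Rightarrow> 'b pair_pre_digraph \<Rightarrow> ('a \<times> 'b) pair_pre_digraph"
    (infixr \<open>\<box>\<close> 70) where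
  "G \<box> H = \<lparr> pverts = pverts G \<times> pverts H,
     parcs = {((a, b), (a', b')).
       (a = a' \<and> a \<in> pverts G \<and> (b, b') \<in> parcs H) \<or>
       ((a, a') \<in> parcs G \<and> b = b' \<and> b \<in> pverts H)} \<rparr>"

lemma pverts_path_inf_square: "pverts (path_inf \<box> path_inf) = UNIV"
  by (simp add: cart_prod_def path_inf_def)

lemma parcs_path_inf_square:
  "((x, y), (x', y')) \<in> parcs (path_inf \<box> path_inf) \<longleftrightarrow>
     (x = x' \<and> \<bar>y - y'\<bar> = 1) \<or> (\<bar>x - x'\<bar> = 1 \<and> y = y')"
  by (auto simp: cart_prod_def path_inf_def)

lemma pair_graph_path_square: "pair_graph (path_graph n \<box> path_graph n)"
proof -
  have "parcs (path_graph n \<box> path_graph n) \<subseteq>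
      pverts (path_graph n \<box> path_graph n) \<times> pverts (path_graph n \<box> path_graph n)"
    by (auto simp: cart_prod_def path_graph_def)
  moreover have "finite (pverts (path_graph n \<box> path_graph n))"
    by (simp add: cart_prod_def path_graph_def)
  ultimately have "finite (parcs (path_graph n \<box> path_graph n))"
    by (meson finite_SigmaI finite_subset)
  then show ?thesis
    by unfold_locales
      (auto simp: cart_prod_def path_graph_def symmetric_def sym_def arcs_ends_conv)
qed

lemma pair_bidirected_path_inf_square: "pair_bidirected_digraph (path_inf \<box> path_inf)"
  by unfold_locales
    (auto simp: cart_prod_def path_inf_def symmetric_def sym_def arcs_ends_conv abs_minus_commute)

definition grid_graph :: "(int \<times> int) pair_pre_digraph \<Rightarrow> bool" where
  "grid_graph G \<longleftrightarrow>
     induced_subgraph (with_proj G) (with_proj (path_inf \<box> path_inf)) \<and>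
     Digraph_Component.connected (with_proj G)"

text \<open>Containment as a subgraph is meant up to isomorphism.\<close>

definition contains_subgraph :: "'a pair_pre_digraph \<Rightarrow> 'b pair_pre_digraph \<Rightarrow> bool" where
  "contains_subgraph G K \<longleftrightarrow>
     (\<exists>H :: 'a pair_pre_digraph. subgraph (with_proj H) (with_proj G) \<and>
        digraph_iso (with_proj K) (with_proj H))"

text \<open>
  A geodesic is given by its list of vertices; a single vertex is a geodesic of length 0.
\<close>

definition geodesic :: "'a pair_pre_digraph \<Rightarrow> 'a list \<Rightarrow> bool" where
  "geodesic G p \<longleftrightarrow> vpath p (with_proj G) \<and>
     (\<forall>q. vpath q (with_proj G) \<and> hd q = hd p \<and> last q = last p \<longrightarrow>
        vwalk_length p \<le> vwalk_length q)"

definition gp_set :: "nat \<Rightarrow> 'a pair_pre_digraph \<Rightarrow> 'a set \<Rightarrow> bool" where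
  "gp_set k G S \<longleftrightarrow> S \<subseteq> pverts G \<and> \<not> (\<exists>p. geodesic G p \<and> card (set p \<inter> S) \<ge> k)"

text \<open>
  The value is \<open>\<infinity>\<close> if an infinite set qualifies or the cardinalities are unbounded;
  a finite value for \<open>k \<ge> 2\<close> is attained, hence a maximum.
\<close>

definition gp :: "nat \<Rightarrow> 'a pair_pre_digraph \<Rightarrow> enat" where
  "gp k G = (SUP S \<in> {S. gp_set k G S}. if finite S then enat (card S) else \<infinity>)"

definition monotone_points :: "(real \<times> real) list \<Rightarrow> bool" where
  "monotone_points ps \<longleftrightarrow>
     (sorted_wrt (\<le>) (map fst ps) \<or> sorted_wrt (\<ge>) (map fst ps)) \<and>
     (sorted_wrt (\<le>) (map snd ps) \<or> sorted_wrt (\<ge>) (map snd ps))"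

text \<open>
  Only the values of \<open>f\<close> on the vertices of \<open>G\<close> matter, so this is a property of the
  restriction of \<open>f\<close> to the vertex set. The vertices \<open>v\<^sub>1, \<dots>, v\<^sub>k\<close> need not be distinct.
\<close>

definition monotone_geodesic_labeling ::
    "nat \<Rightarrow> 'a pair_pre_digraph \<Rightarrow> ('a \<Rightarrow> real \<times> real) \<Rightarrow> bool" where
  "monotone_geodesic_labeling k G f \<longleftrightarrow> inj_on f (pverts G) \<and>
     (\<forall>vs. length vs = k \<and> set vs \<subseteq> pverts G \<and> monotone_points (map f vs) \<longrightarrow>
        (\<exists>g. geodesic G g \<and> set vs \<subseteq> set g))"

definition natural_labeling :: "int \<times> int \<Rightarrow> real \<times> real" where
  "natural_labeling = (\<lambda>(x, y). (of_int x, of_int y))"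

end

theory Submission
  imports Defs "HOL-Library.Product_Plus"
begin

text \<open>
  Upper bound: by the Erdos--Szekeres pigeonhole argument, more than \<open>(k - 1)\<^sup>2\<close> points contain a
  monotone sequence of \<open>k\<close> distinct points, which the labeling hypothesis places on a geodesic.
  Lower bound: an embedding of a square grid into \<open>\<int>\<^sup>2\<close> is rigid, so \<open>G\<close> contains all vertices of an
  axis-parallel box of side \<open>2k - 3\<close>. Inside it, take the points \<open>(i - j, i + j)\<close> with
  \<open>0 \<le> i, j \<le> k - 2\<close>, suitably translated. Between vertices of the box a geodesic of \<open>G\<close> realises the
  \<open>\<ell>\<^sup>1\<close>-distance, so along a geodesic \<open>x + y\<close> or \<open>x - y\<close> separates the chosen points it meets;
  each of these two functions takes only \<open>k - 1\<close> values on the chosen points.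
\<close>

section \<open>Chains in the union of two orders\<close>

text \<open>Label each point with the greatest lengths of an \<open>R\<close>-chain and of a
  \<open>Q\<close>-chain in \<open>S\<close> ending there. Of two distinct points, the later one in
  a chain has a strictly larger label, so the label pairs are injective; without a chain of length
  \<open>k\<close> at most \<open>(k - 1)\<^sup>2\<close> pairs occur.\<close>

lemma long_chain_exists:
  fixes R Q :: "'a \<Rightarrow> 'a \<Rightarrow> bool"
  assumes fin: "finite S" and card: "(k - 1)\<^sup>2 < card S"
    and trans: "transp R" "transp Q"
    and comparable: "\<And>x y. x \<in> S \<Longrightarrow> y \<in> S \<Longrightarrow> x \<noteq> y \<Longrightarrow> R x y \<or> R y x \<or> Q x y \<or> Q y x"
  shows "\<exists>vs. length vs = k \<and> set vs \<subseteq> S \<and> (sorted_wrt R vs \<or> sorted_wrt Q vs)"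
proof (rule ccontr)
  define L where "L P x = {length vs | vs. vs \<noteq> [] \<and> set vs \<subseteq> S \<and> sorted_wrt P vs \<and> last vs = x}"
    for P :: "'a \<Rightarrow> 'a \<Rightarrow> bool" and x
  assume none: "\<not> ?thesis"
  then have no_chain: "\<not> sorted_wrt P vs" if "length vs = k" "set vs \<subseteq> S" "P = R \<or> P = Q" for P vs
    using that none by blast
  \<comment> \<open>A prefix of a chain is a chain, so a longer chain would yield one of length
    exactly \<open>k\<close>.\<close>
  have L_less: "n < k" if n: "n \<in> L P x" and "P = R \<or> P = Q" for n P x
  proof (rule ccontr)
    assume "\<not> n < k"
    obtain vs where "n = length vs" "set vs \<subseteq> S" "sorted_wrt P vs"
      using n by (auto simp: L_def)
    with \<open>\<not> n < k\<close> have "length (take k vs) = k" "set (take k vs) \<subseteq> S" "sorted_wrt P (take k vs)"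
      using set_take_subset[of k vs] by (auto simp: sorted_wrt_take)
    then show False
      using no_chain \<open>P = R \<or> P = Q\<close> by blast
  qed
  have L_fin: "finite (L P x)" if "P = R \<or> P = Q" for P x
    using L_less[OF _ that] by (metis bounded_nat_set_is_finite)
  have one_in_L: "1 \<in> L P x" if "x \<in> S" for P x
    using that by (auto simp: L_def intro!: exI[of _ "[x]"])
  have L_mono: "Max (L P x) < Max (L P y)" if "P = R \<or> P = Q" "x \<in> S" "y \<in> S" "P x y" for P x y
  proof -
    have "Max (L P x) \<in> L P x"
      using Max_in[OF L_fin[OF that(1)]] one_in_L[OF that(2)] by blast
    then obtain vs where vs: "Max (L P x) = length vs" "vs \<noteq> []" "set vs \<subseteq> S" "sorted_wrt P vs"
        "last vs = x"
      by (auto simp: L_def)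
    \<comment> \<open>Every entry equals \<open>x\<close> or is related to it, so by transitivity
      \<open>y\<close> can be appended to the chain.\<close>
    have "P z y" if "z \<in> set vs" for z
    proof -
      have "vs = butlast vs @ [x]"
        using vs(2,5) append_butlast_last_id by fastforce
      then have "z = x \<or> P z x"
        using vs(4) \<open>z \<in> set vs\<close>
        by (metis Un_iff empty_iff list.set(1) set_ConsD set_append sorted_wrt_append list.set_intros(1))
      then show ?thesis
        using \<open>P x y\<close> \<open>P = R \<or> P = Q\<close> trans by (metis transpD)
    qed
    then have "Suc (length vs) \<in> L P y"
      using vs \<open>y \<in> S\<close> by (auto simp: L_def sorted_wrt_append intro!: exI[of _ "vs @ [y]"])
    then show ?thesis
      using Max_ge[OF L_fin[OF that(1)]] vs(1) by fastforce
  qed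
  have Max_range: "Max (L P x) \<in> {1..<k}" if "P = R \<or> P = Q" "x \<in> S" for P x
    using L_less[OF _ that(1)] Max_in[OF L_fin[OF that(1)]] Max_ge[OF L_fin[OF that(1)]]
      one_in_L[OF that(2)] by (metis atLeastLessThan_iff empty_iff)
  have "inj_on (\<lambda>x. (Max (L R x), Max (L Q x))) S"
  proof (rule inj_onI, rule ccontr)
    fix x y
    assume "x \<in> S" "y \<in> S" "(Max (L R x), Max (L Q x)) = (Max (L R y), Max (L Q y))" "x \<noteq> y"
    then show False
      using comparable[of x y] L_mono[of R] L_mono[of Q] by (metis less_irrefl prod.inject)
  qed
  moreover have "(\<lambda>x. (Max (L R x), Max (L Q x))) ` S \<subseteq> {1..<k} \<times> {1..<k}"
    using Max_range by blast
  ultimately have "card S \<le> card ({1..<k} \<times> {1..<k})"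
    by (intro card_inj_on_le) auto
  then show False
    using card by (simp add: power2_eq_square)
qed

section \<open>Rigidity of square grids in the integer lattice\<close>

definition l1_dist :: "int \<times> int \<Rightarrow> int \<times> int \<Rightarrow> int" where
  "l1_dist p q = \<bar>fst p - fst q\<bar> + \<bar>snd p - snd q\<bar>"

lemma parcs_path_inf_square_iff:
  "(p, q) \<in> parcs (path_inf \<box> path_inf) \<longleftrightarrow> l1_dist p q = 1"
  by (cases p; cases q) (auto simp: parcs_path_inf_square l1_dist_def)

lemma l1_dist_eq_1D:
  assumes "l1_dist p q = 1"
  shows "q = p + (1, 0) \<or> q = p + (- 1, 0) \<or> q = p + (0, 1) \<or> q = p + (0, - 1)"
  using assms by (cases p; cases q) (auto simp: l1_dist_def)

text \<open>If \<open>b\<close> and \<open>d\<close> lay on opposite sides of \<open>a\<close>,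
  their only common neighbour would be \<open>a\<close>. So the two steps out of \<open>a\<close>
  are perpendicular, and the other common neighbour completes the square. For a unit step, a zero
  first coordinate means vertical; this encodes perpendicularity throughout.\<close>

lemma four_cycle_is_unit_square:
  assumes "l1_dist a b = 1" "l1_dist b c = 1" "l1_dist a d = 1" "l1_dist d c = 1" "a \<noteq> c" "b \<noteq> d"
  shows "c - d = b - a \<and> (fst (b - a) = 0) \<noteq> (fst (d - a) = 0)"
proof -
  have "b = a + (1, 0) \<or> b = a + (- 1, 0) \<or> b = a + (0, 1) \<or> b = a + (0, - 1)"
    "d = a + (1, 0) \<or> d = a + (- 1, 0) \<or> d = a + (0, 1) \<or> d = a + (0, - 1)"
    using assms l1_dist_eq_1D by blast+
  moreover have "c = b + (1, 0) \<or> c = b + (- 1, 0) \<or> c = b + (0, 1) \<or> c = b + (0, - 1)"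
    using assms l1_dist_eq_1D by blast
  ultimately show ?thesis
    using assms(4-6) by (elim disjE) (simp_all add: l1_dist_def prod_eq_iff)
qed

lemma perpendicular_unit_steps:
  fixes u v :: "int \<times> int" and m :: nat
  assumes "\<bar>fst u\<bar> + \<bar>snd u\<bar> = 1" "\<bar>fst v\<bar> + \<bar>snd v\<bar> = 1" "(fst u = 0) \<noteq> (fst v = 0)"
  shows "\<exists>a b. \<forall>x \<in> {a..<a + int m}. \<forall>y \<in> {b..<b + int m}.
    \<exists>i<m. \<exists>j<m. (x, y) = (fst p + int i * fst u + int j * fst v, snd p + int i * snd u + int j * snd v)"
proof -
  \<comment> \<open>One vector is horizontal and the other vertical, so these are the signs of the
    horizontal and the vertical step. For a negative sign, \<open>p\<close> is the upper end of the
    box in that coordinate, whence the offset \<open>m - 1\<close>.\<close>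
  define \<sigma> \<tau> where "\<sigma> = fst u + fst v" and "\<tau> = snd u + snd v"
  define a where "a = (if \<sigma> = 1 then fst p else fst p - (int m - 1))"
  define b where "b = (if \<tau> = 1 then snd p else snd p - (int m - 1))"
  have \<sigma>: "\<sigma> = 1 \<or> \<sigma> = - 1" and \<tau>: "\<tau> = 1 \<or> \<tau> = - 1"
    using assms by (auto simp: \<sigma>_def \<tau>_def)
  have "\<forall>x \<in> {a..<a + int m}. \<forall>y \<in> {b..<b + int m}.
    \<exists>i<m. \<exists>j<m. (x, y) = (fst p + int i * fst u + int j * fst v, snd p + int i * snd u + int j * snd v)"
  proof (intro ballI)
    fix x y
    assume xy: "x \<in> {a..<a + int m}" "y \<in> {b..<b + int m}"
    define s t where "s = nat (\<sigma> * (x - fst p))" and "t = nat (\<tau> * (y - snd p))"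
    have st: "s < m" "t < m" "x = fst p + \<sigma> * int s" "y = snd p + \<tau> * int t"
      using xy \<sigma> \<tau> by (auto simp: s_def t_def a_def b_def)
    show "\<exists>i<m. \<exists>j<m. (x, y) = (fst p + int i * fst u + int j * fst v, snd p + int i * snd u + int j * snd v)"
    \<comment> \<open>\<open>s\<close> counts horizontal and \<open>t\<close> vertical steps; which
      of them multiplies \<open>u\<close> depends on the direction of \<open>u\<close>.\<close>
    proof (cases "fst u = 0")
      case True
      then have "snd v = 0"
        using assms by auto
      with True st show ?thesis
        by (intro exI[of _ t] exI[of _ s] conjI) (auto simp: \<sigma>_def \<tau>_def)
    next
      case False
      then have "snd u = 0" "fst v = 0"
        using assms by auto
      with st show ?thesis
        by (intro exI[of _ s] exI[of _ t] conjI) (auto simp: \<sigma>_def \<tau>_def)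
    qed
  qed
  then show ?thesis
    by blast
qed

text \<open>Each grid square maps to a unit square, so opposite sides carry the same step and
  adjacent sides are perpendicular. Hence all steps along one index are parallel, and injectivity
  forbids reversals; the image is an affine copy of the grid.\<close>

lemma grid_embedding_contains_box:
  fixes f :: "nat \<times> nat \<Rightarrow> int \<times> int"
  assumes inj: "inj_on f ({..<m} \<times> {..<m})"
    and step1: "\<And>i j. Suc i < m \<Longrightarrow> j < m \<Longrightarrow> l1_dist (f (i, j)) (f (Suc i, j)) = 1"
    and step2: "\<And>i j. i < m \<Longrightarrow> Suc j < m \<Longrightarrow> l1_dist (f (i, j)) (f (i, Suc j)) = 1"
  obtains a b where "{a..<a + int m} \<times> {b..<b + int m} \<subseteq> f ` ({..<m} \<times> {..<m})"
proof -
  have neq: "f p \<noteq> f q" if "p \<in> {..<m} \<times> {..<m}" "q \<in> {..<m} \<times> {..<m}" "p \<noteq> q" for p q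
    using inj that by (auto dest: inj_onD)
  consider "m = 0" | "m = 1" | "2 \<le> m"
    by linarith
  then show ?thesis
  proof cases
    case 1
    then show ?thesis
      using that by auto
  next
    \<comment> \<open>A single vertex has no step vectors. The theorem reaches this case for
      \<open>k = 2\<close>.\<close>
    case 2
    have "{fst (f (0, 0))..<fst (f (0, 0)) + int m} \<times> {snd (f (0, 0))..<snd (f (0, 0)) + int m}
        \<subseteq> f ` ({..<m} \<times> {..<m})"
      using 2 by (auto simp: prod_eq_iff image_iff)
    then show ?thesis
      by (rule that)
  next
    case 3
    define u where "u i = f (Suc i, 0) - f (i, 0)" for i
    define v where "v j = f (0, Suc j) - f (0, j)" for j
    have square: "f (Suc i, Suc j) - f (i, Suc j) = f (Suc i, j) - f (i, j)"
      "(fst (f (Suc i, j) - f (i, j)) = 0) \<noteq> (fst (f (i, Suc j) - f (i, j)) = 0)"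
      if "Suc i < m" "Suc j < m" for i j
      using four_cycle_is_unit_square[of "f (i, j)" "f (Suc i, j)" "f (Suc i, Suc j)" "f (i, Suc j)"]
        step1[of i j] step1[of i "Suc j"] step2[of i j] step2[of "Suc i" j] neq that
      by auto
    \<comment> \<open>Crossing one square at a time carries the step at height \<open>j\<close> back
      to height \<open>0\<close>.\<close>
    have u: "f (Suc i, j) - f (i, j) = u i" if "Suc i < m" "j < m" for i j
      using that(2) by (induction j) (use that(1) square(1) in \<open>auto simp: u_def\<close>)
    have v: "f (i, Suc j) - f (i, j) = v j" if "i < m" "Suc j < m" for i j
      using that(1)
    proof (induction i)
      case (Suc i)
      then show ?case
        using square(1)[of i j] that(2) by (simp add: algebra_simps)
    qed (simp add: v_def)
    have perp: "(fst (u i) = 0) \<noteq> (fst (v j) = 0)" if "Suc i < m" "Suc j < m" for i j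
      using square(2)[OF that] u[of i j] v[of i j] that by simp
    have unit: "\<bar>fst (u i)\<bar> + \<bar>snd (u i)\<bar> = 1" "\<bar>fst (v i)\<bar> + \<bar>snd (v i)\<bar> = 1" if "Suc i < m" for i
      using step1[of i 0] step2[of 0 i] that by (auto simp: u_def v_def l1_dist_def)
    have no_turn: "u i + u (Suc i) \<noteq> 0" "v i + v (Suc i) \<noteq> 0" if "Suc (Suc i) < m" for i
      using neq[of "(Suc (Suc i), 0)" "(i, 0)"] neq[of "(0, Suc (Suc i))" "(0, i)"] that
      by (auto simp: u_def v_def)
    have same: "z = w" if "\<bar>fst z\<bar> + \<bar>snd z\<bar> = 1" "\<bar>fst w\<bar> + \<bar>snd w\<bar> = 1" "(fst z = 0) = (fst w = 0)"
      "z + w \<noteq> 0" for z w :: "int \<times> int"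
      using that by (cases z; cases w) (auto simp: zero_prod_def)
    \<comment> \<open>\<open>u i\<close> and \<open>u (Suc i)\<close> are both perpendicular to
      \<open>v 0\<close>, hence parallel; not being opposite, they agree.\<close>
    have u0: "u i = u 0" if "Suc i < m" for i
      using that
    proof (induction i)
      case (Suc i)
      then have "u i = u (Suc i)"
        using same[of "u i" "u (Suc i)"] unit no_turn(1)[of i] perp[of i 0] perp[of "Suc i" 0] 3 by simp
      then show ?case
        using Suc by simp
    qed simp
    have v0: "v j = v 0" if "Suc j < m" for j
      using that
    proof (induction j)
      case (Suc j)
      then have "v j = v (Suc j)"
        using same[of "v j" "v (Suc j)"] unit no_turn(2)[of j] perp[of 0 j] perp[of 0 "Suc j"] 3 by simp
      then show ?case
        using Suc by simp
    qed simp
    have row: "f (i, 0) = (fst (f (0, 0)) + int i * fst (u 0), snd (f (0, 0)) + int i * snd (u 0))"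
      if "i < m" for i
      using that
    proof (induction i)
      case (Suc i)
      then show ?case
        using u[of i 0] u0[of i] by (auto simp: prod_eq_iff algebra_simps)
    qed simp
    have f_eq: "f (i, j) = (fst (f (0, 0)) + int i * fst (u 0) + int j * fst (v 0),
        snd (f (0, 0)) + int i * snd (u 0) + int j * snd (v 0))" if "i < m" "j < m" for i j
      using that(2)
    proof (induction j)
      case 0
      then show ?case
        using row[OF that(1)] by simp
    next
      case (Suc j)
      then have "f (i, Suc j) = f (i, j) + v 0"
        using v[OF \<open>i < m\<close> \<open>Suc j < m\<close>] v0[OF \<open>Suc j < m\<close>] by (metis diff_add_cancel add.commute)
      moreover note Suc.IH[OF Suc_lessD[OF \<open>Suc j < m\<close>]]
      ultimately show ?case
        by (simp add: prod_eq_iff distrib_right)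
    qed
    have m: "Suc 0 < m"
      using 3 by simp
    obtain a b where ab: "\<forall>x \<in> {a..<a + int m}. \<forall>y \<in> {b..<b + int m}.
        \<exists>i<m. \<exists>j<m. (x, y) = (fst (f (0, 0)) + int i * fst (u 0) + int j * fst (v 0),
          snd (f (0, 0)) + int i * snd (u 0) + int j * snd (v 0))"
      using perpendicular_unit_steps[OF unit(1)[OF m] unit(2)[OF m] perp[OF m m], of m "f (0, 0)"]
      by blast
    have "{a..<a + int m} \<times> {b..<b + int m} \<subseteq> f ` ({..<m} \<times> {..<m})"
    proof clarify
      fix x y
      assume "x \<in> {a..<a + int m}" "y \<in> {b..<b + int m}"
      then obtain i j where ij: "i < m" "j < m"
        and xy: "(x, y) = (fst (f (0, 0)) + int i * fst (u 0) + int j * fst (v 0),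
          snd (f (0, 0)) + int i * snd (u 0) + int j * snd (v 0))"
        using ab by blast
      have "(x, y) = f (i, j)"
        unfolding xy using f_eq[OF ij] by (rule sym)
      then show "(x, y) \<in> f ` ({..<m} \<times> {..<m})"
        using ij by (intro image_eqI[of _ _ "(i, j)"]) auto
    qed
    then show ?thesis
      by (rule that)
  qed
qed

section \<open>Geodesics of grid graphs\<close>

text \<open>Adjacency of consecutive entries splits over \<open>@\<close>, so in this form walks can
  be spliced.\<close>

lemma vwalk_iff_successively:
  "vwalk p G \<longleftrightarrow> p \<noteq> [] \<and> set p \<subseteq> verts G \<and> successively (\<lambda>x y. (x, y) \<in> arcs_ends G) p"
proof -
  have "set (vwalk_arcs p) \<subseteq> E \<longleftrightarrow> successively (\<lambda>x y. (x, y) \<in> E) p" for E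
    by (induction p rule: vwalk_arcs.induct) auto
  then show ?thesis
    by (auto simp: vwalk_def)
qed

lemma length_vwalk_to_vpath_le: "length (vwalk_to_vpath p) \<le> length p"
proof (induction p rule: vwalk_to_vpath_induct3)
  case (in_set x xs)
  then show ?case
    using length_dropWhile_le[of "\<lambda>y. y \<noteq> x" xs] by simp
qed auto

text \<open>Replacing the segment from \<open>u\<close> to \<open>v\<close> by \<open>r\<close>
  gives a walk with the same ends. It may repeat vertices, while \<open>geodesic\<close> compares
  with paths only, so it is first shortened to a path.\<close>

lemma geodesic_segment_shortest:
  assumes geo: "geodesic G (xs @ u # ys @ v # zs)"
    and r: "vwalk r (with_proj G)" "hd r = u" "last r = v"
  shows "length ys + 2 \<le> length r"
proof -
  let ?p = "xs @ u # ys @ v # zs" and ?q = "xs @ r @ zs"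
  have p: "vwalk ?p (with_proj G)"
    using geo by (auto simp: geodesic_def)
  have "r \<noteq> []"
    using r by auto
  have "vwalk ?q (with_proj G)"
    using p r by (auto simp: vwalk_iff_successively successively_append_iff successively_Cons)
  moreover have "hd ?q = hd ?p" "last ?q = last ?p"
    using r \<open>r \<noteq> []\<close> by (auto simp: hd_append)
  ultimately have "vwalk_length ?p \<le> vwalk_length (vwalk_to_vpath ?q)"
    using geo by (metis geodesic_def vwalk_to_vpath_hd vwalk_to_vpath_last vwalk_to_vpath_vpath)
  then show ?thesis
    using length_vwalk_to_vpath_le[of ?q] \<open>r \<noteq> []\<close> by (cases r) auto
qed

text \<open>The form in which inducedness is used: once two lattice neighbours are vertices, the
  edge is there.\<close>

locale grid =
  fixes G :: "(int \<times> int) pair_pre_digraph"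
  assumes arcs_iff: "(p, q) \<in> parcs G \<longleftrightarrow> p \<in> pverts G \<and> q \<in> pverts G \<and> l1_dist p q = 1"
begin

lemma l1_dist_le_walk:
  assumes "vwalk p (with_proj G)"
  shows "l1_dist (hd p) (last p) \<le> int (length p) - 1"
  using assms
proof (induction p rule: vwalk_induct)
  case (Base u)
  then show ?case
    by (simp add: l1_dist_def)
next
  case (Cons u v es)
  then show ?case
    by (auto simp: arcs_iff l1_dist_def split: if_splits)
qed

text \<open>Correcting first the first coordinate, then the second, never leaves the box, all of
  whose points are vertices.\<close>

lemma box_walk:
  fixes a b :: int and m :: int
  defines "B \<equiv> {a..<a + m} \<times> {b..<b + m}"
  assumes box: "B \<subseteq> pverts G" and "p \<in> B" "q \<in> B"
  obtains r where "vwalk r (with_proj G)" "hd r = p" "last r = q" "int (length r) = l1_dist p q + 1"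
proof -
  have "\<exists>r. vwalk r (with_proj G) \<and> hd r = p \<and> last r = q \<and> length r = Suc n"
    if "p \<in> B" "l1_dist p q = int n" for n
    using that
  proof (induction n arbitrary: p)
    case 0
    then have "p = q"
      by (auto simp: l1_dist_def prod_eq_iff)
    then show ?case
      using 0 box by (intro exI[of _ "[p]"]) auto
  next
    case (Suc n)
    define p' where "p' = (if fst p \<noteq> fst q then (fst p + sgn (fst q - fst p), snd p)
      else (fst p, snd p + sgn (snd q - snd p)))"
    have p': "p' \<in> B" "l1_dist p p' = 1" "l1_dist p' q = int n"
      using Suc.prems \<open>q \<in> B\<close>
      by (cases p; cases q; auto simp: p'_def l1_dist_def B_def sgn_if)+
    obtain r where r: "vwalk r (with_proj G)" "hd r = p'" "last r = q" "length r = Suc n"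
      using Suc.IH[OF p'(1,3)] by blast
    have "vwalk (p # r) (with_proj G)"
      using r p' box Suc.prems(1) by (intro vwalk_consI) (auto simp: arcs_iff)
    then show ?case
      using r by (intro exI[of _ "p # r"]) auto
  qed
  moreover have "l1_dist p q = int (nat (l1_dist p q))"
    by (simp add: l1_dist_def)
  ultimately show ?thesis
    using that \<open>p \<in> B\<close> by (metis of_nat_Suc add.commute)
qed

text \<open>A walk inside the box bounds \<open>j - i\<close> from above by the
  \<open>l1_dist\<close>, and \<open>l1_dist_le_walk\<close> on the segment itself bounds it from
  below. Only the two end vertices have to lie in the box.\<close>

lemma geodesic_isometric_on_box:
  fixes a b :: int and m :: int
  defines "B \<equiv> {a..<a + m} \<times> {b..<b + m}"
  assumes box: "B \<subseteq> pverts G" and geo: "geodesic G p"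
    and ij: "i \<le> j" "j < length p" and in_box: "p ! i \<in> B" "p ! j \<in> B"
  shows "l1_dist (p ! i) (p ! j) = int j - int i"
proof (cases "i = j")
  case True
  then show ?thesis
    by (simp add: l1_dist_def)
next
  case False
  \<comment> \<open>The vertices strictly between positions \<open>i\<close> and \<open>j\<close>;
    this brings \<open>p\<close> into the shape of \<open>geodesic_segment_shortest\<close>.\<close>
  define ys where "ys = take (j - i - 1) (drop (Suc i) p)"
  have ys: "length ys = j - i - 1"
    using ij by (simp add: ys_def)
  have "drop (Suc i) p = ys @ p ! j # drop (Suc j) p"
    using ij False id_take_nth_drop[of "j - i - 1" "drop (Suc i) p"] by (simp add: ys_def)
  then have p: "p = take i p @ p ! i # ys @ p ! j # drop (Suc j) p"
    using ij id_take_nth_drop[of i p] by simp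
  obtain r where "vwalk r (with_proj G)" "hd r = p ! i" "last r = p ! j"
      "int (length r) = l1_dist (p ! i) (p ! j) + 1"
    using box_walk[of a m b "p ! i" "p ! j"] box in_box unfolding B_def by metis
  then have "int j - int i \<le> l1_dist (p ! i) (p ! j)"
    using geodesic_segment_shortest[of G "take i p" "p ! i" ys "p ! j" "drop (Suc j) p" r] p geo ys ij False
    by simp
  moreover have "vwalk (p ! i # ys @ [p ! j]) (with_proj G)"
  proof -
    have "vwalk (take i p @ (p ! i # ys @ [p ! j]) @ drop (Suc j) p) (with_proj G)"
      using geo p by (auto simp: geodesic_def)
    then show ?thesis
      using vwalkI_append_l vwalkI_append_r by blast
  qed
  from l1_dist_le_walk[OF this] have "l1_dist (p ! i) (p ! j) \<le> int j - int i"
    using ys ij False by simp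
  ultimately show ?thesis
    by simp
qed

text \<open>Let \<open>s\<close> and \<open>t\<close> be the first and last box vertices on the
  geodesic. By isometry, distances from \<open>s\<close> and to \<open>t\<close> add up for every
  box vertex in between, so it lies in the rectangle spanned by \<open>s\<close> and
  \<open>t\<close>.\<close>

lemma geodesic_inj_on_box:
  fixes a b :: int and m :: int
  defines "B \<equiv> {a..<a + m} \<times> {b..<b + m}"
  assumes box: "B \<subseteq> pverts G" and geo: "geodesic G p"
  shows "inj_on (\<lambda>v. fst v + snd v) (set p \<inter> B) \<or> inj_on (\<lambda>v. fst v - snd v) (set p \<inter> B)"
proof (cases "set p \<inter> B = {}")
  case False
  define I where "I = {i. i < length p \<and> p ! i \<in> B}"
  obtain w where "w \<in> set p" "w \<in> B"
    using False by blast
  then obtain i where "i \<in> I"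
    by (auto simp: I_def in_set_conv_nth)
  then have I: "finite I" "I \<noteq> {}"
    by (auto simp: I_def)
  define s t where "s = p ! Min I" and "t = p ! Max I"
  have dist: "l1_dist (p ! i) (p ! j) = int j - int i" if "i \<in> I" "j \<in> I" "i \<le> j" for i j
    using geodesic_isometric_on_box[of a m b p i j] box geo that by (simp add: I_def B_def)
  have between: "l1_dist s (p ! i) = int i - int (Min I)" "l1_dist (p ! i) t = int (Max I) - int i"
    "l1_dist s t = int (Max I) - int (Min I)" if "i \<in> I" for i
    using dist[of "Min I" i] dist[of i "Max I"] dist[of "Min I" "Max I"] I that
    by (simp_all add: s_def t_def)
  have eqI: "v = w" if vw: "v \<in> set p \<inter> B" "w \<in> set p \<inter> B"
    and det: "\<And>i j. i \<in> I \<Longrightarrow> j \<in> I \<Longrightarrow> v = p ! i \<Longrightarrow> w = p ! j \<Longrightarrow> int i = int j" for v w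
  proof -
    obtain i j where "i \<in> I" "j \<in> I" "v = p ! i" "w = p ! j"
      using vw by (auto simp: I_def in_set_conv_nth)
    with det[of i j] show ?thesis
      by simp
  qed
  show ?thesis
  \<comment> \<open>If \<open>t - s\<close> does not have coordinates of opposite sign, then in that
    rectangle the change of \<open>x + y\<close> from \<open>s\<close> is, up to a fixed sign, the
    distance from \<open>s\<close>, which determines the position on the geodesic. Otherwise
    \<open>x - y\<close> does the same.\<close>
  proof (cases "(fst s \<le> fst t) = (snd s \<le> snd t)")
    case True
    have "inj_on (\<lambda>v. fst v + snd v) (set p \<inter> B)"
    proof (rule inj_onI)
      fix v w
      assume vw: "v \<in> set p \<inter> B" "w \<in> set p \<inter> B" and eq: "fst v + snd v = fst w + snd w"
      show "v = w"
      proof (rule eqI[OF vw])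
        fix i j
        assume "i \<in> I" "j \<in> I" "v = p ! i" "w = p ! j"
        then show "int i = int j"
          using between[of i] between[of j] eq True unfolding l1_dist_def by (smt (verit))
      qed
    qed
    then show ?thesis ..
  next
    case False
    have "inj_on (\<lambda>v. fst v - snd v) (set p \<inter> B)"
    proof (rule inj_onI)
      fix v w
      assume vw: "v \<in> set p \<inter> B" "w \<in> set p \<inter> B" and eq: "fst v - snd v = fst w - snd w"
      show "v = w"
      proof (rule eqI[OF vw])
        fix i j
        assume "i \<in> I" "j \<in> I" "v = p ! i" "w = p ! j"
        then show "int i = int j"
          using between[of i] between[of j] eq False unfolding l1_dist_def by (smt (verit))
      qed
    qed
    then show ?thesis ..
  qed
qed simp

section \<open>A large set in general position\<close>

lemma gp_set_in_box:
  fixes a b :: int and k :: nat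
  assumes k: "2 \<le> k" and box: "{a..<a + int (2 * k - 3)} \<times> {b..<b + int (2 * k - 3)} \<subseteq> pverts G"
  obtains S where "gp_set k G S" "finite S" "card S = (k - 1)\<^sup>2"
proof
  \<comment> \<open>The shift \<open>k - 2\<close> makes the first offset nonnegative; both offsets
    then run through \<open>0\<close> to \<open>2 * k - 4\<close>, exactly the side of the
    box.\<close>
  define pt where "pt = (\<lambda>(i, j). (a + int i - int j + int (k - 2), b + int i + int j))"
  define S where "S = pt ` ({..<k - 1} \<times> {..<k - 1})"
  let ?B = "{a..<a + int (2 * k - 3)} \<times> {b..<b + int (2 * k - 3)}"
  have "inj_on pt ({..<k - 1} \<times> {..<k - 1})"
    by (auto simp: inj_on_def pt_def)
  then show "card S = (k - 1)\<^sup>2"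
    by (simp add: S_def card_image power2_eq_square)
  show "finite S"
    by (simp add: S_def)
  have S_box: "S \<subseteq> ?B"
    using k by (auto simp: S_def pt_def)
  have few: "card T < k" if "T \<subseteq> S" "inj_on g T" "g ` S \<subseteq> h ` {..<k - 1}"
    for T and g :: "int \<times> int \<Rightarrow> int" and h :: "nat \<Rightarrow> int"
  proof -
    have "card T \<le> card (h ` {..<k - 1})"
      using that by (intro card_inj_on_le[of g]) auto
    also have "\<dots> \<le> k - 1"
      using card_image_le[of "{..<k - 1}" h] by simp
    finally show ?thesis
      using k by simp
  qed
  have "card (set p \<inter> S) < k" if "geodesic G p" for p
  proof -
    have sub: "set p \<inter> S \<subseteq> set p \<inter> ?B" "set p \<inter> S \<subseteq> S"
      using S_box by auto
    \<comment> \<open>The sum depends on \<open>i\<close> only and the difference on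
      \<open>j\<close> only.\<close>
    have "(\<lambda>v. fst v + snd v) ` S \<subseteq> (\<lambda>i. a + b + int (k - 2) + 2 * int i) ` {..<k - 1}"
      "(\<lambda>v. fst v - snd v) ` S \<subseteq> (\<lambda>j. a - b + int (k - 2) - 2 * int j) ` {..<k - 1}"
      by (auto simp: S_def pt_def)
    then show ?thesis
      using geodesic_inj_on_box[OF box that] few[OF sub(2)] inj_on_subset[OF _ sub(1)] by blast
  qed
  then show "gp_set k G S"
    using S_box box by (auto simp: gp_set_def not_le)
qed

end

section \<open>The general position number\<close>

lemma grid_graph_imp_grid:
  assumes "grid_graph G"
  shows "grid G"
proof
  fix p q
  have "parcs G = {e \<in> parcs (path_inf \<box> path_inf). fst e \<in> pverts G \<and> snd e \<in> pverts G}"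
    using assms by (simp add: grid_graph_def induced_subgraph_def)
  then have "(p, q) \<in> parcs G \<longleftrightarrow>
      (p, q) \<in> parcs (path_inf \<box> path_inf) \<and> p \<in> pverts G \<and> q \<in> pverts G"
    by auto
  then show "(p, q) \<in> parcs G \<longleftrightarrow> p \<in> pverts G \<and> q \<in> pverts G \<and> l1_dist p q = 1"
    by (auto simp: parcs_path_inf_square_iff)
qed

section \<open>From an abstract subgraph to a box of vertices\<close>

lemma contains_subgraph_embedding:
  assumes "contains_subgraph G K"
  obtains f where "inj_on f (pverts K)" "f ` pverts K \<subseteq> pverts G"
    "\<And>x y. (x, y) \<in> parcs K \<Longrightarrow> (f x, f y) \<in> parcs G"
proof -
  obtain H h where H: "subgraph (with_proj H) (with_proj G)"
    and h: "pre_digraph.digraph_isomorphism (with_proj K) h" "with_proj H = app_iso h (with_proj K)"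
    using assms by (auto simp: contains_subgraph_def digraph_iso_def)
  \<comment> \<open>Since \<open>H\<close> is a pair digraph, the tail and head maps of the image
    are the projections, so the arc map is determined by the vertex map.\<close>
  have proj: "iso_tail h = fst" "iso_head h = snd" "pverts H = iso_verts h ` pverts K"
    "parcs H = iso_arcs h ` parcs K"
    using arg_cong[OF h(2), of tail] arg_cong[OF h(2), of head] arg_cong[OF h(2), of verts]
      arg_cong[OF h(2), of arcs] by simp_all
  show ?thesis
  proof
    show "inj_on (iso_verts h) (pverts K)"
      using h(1) by (simp add: pre_digraph.digraph_isomorphism_def)
    show "iso_verts h ` pverts K \<subseteq> pverts G"
      using H proj by (simp add: subgraph_def)
    fix x y
    assume xy: "(x, y) \<in> parcs K"
    then have "iso_arcs h (x, y) = (iso_verts h x, iso_verts h y)"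
      using h(1) proj by (auto simp: pre_digraph.digraph_isomorphism_def prod_eq_iff)
    moreover have "iso_arcs h (x, y) \<in> parcs G"
      using xy H proj by (auto simp: subgraph_def)
    ultimately show "(iso_verts h x, iso_verts h y) \<in> parcs G"
      by simp
  qed
qed

lemma grid_contains_box:
  assumes "grid G" "contains_subgraph G (path_graph m \<box> path_graph m)"
  obtains a b where "{a..<a + int m} \<times> {b..<b + int m} \<subseteq> pverts G"
proof -
  interpret grid G
    by fact
  have verts: "pverts (path_graph m \<box> path_graph m) = {..<m} \<times> {..<m}"
    by (simp add: cart_prod_def path_graph_def)
  obtain f where f: "inj_on f ({..<m} \<times> {..<m})" "f ` ({..<m} \<times> {..<m}) \<subseteq> pverts G"
    "\<And>x y. (x, y) \<in> parcs (path_graph m \<box> path_graph m) \<Longrightarrow> (f x, f y) \<in> parcs G"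
    using contains_subgraph_embedding[OF assms(2)] unfolding verts by metis
  have "l1_dist (f (i, j)) (f (Suc i, j)) = 1" if "Suc i < m" "j < m" for i j
    using f(3)[of "(i, j)" "(Suc i, j)"] that by (auto simp: arcs_iff cart_prod_def path_graph_def)
  moreover have "l1_dist (f (i, j)) (f (i, Suc j)) = 1" if "i < m" "Suc j < m" for i j
    using f(3)[of "(i, j)" "(i, Suc j)"] that by (auto simp: arcs_iff cart_prod_def path_graph_def)
  ultimately show ?thesis
    using grid_embedding_contains_box[OF f(1)] f(2) that by (metis subset_trans)
qed

section \<open>Upper bound\<close>

lemma card_gp_set_le:
  assumes lab: "monotone_geodesic_labeling k G natural_labeling"
    and gp: "gp_set k G S" and fin: "finite S"
  shows "card S \<le> (k - 1)\<^sup>2"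
proof (rule ccontr)
  assume "\<not> card S \<le> (k - 1)\<^sup>2"
  \<comment> \<open>Two points are always comparable in one of the two orders. Requiring
    \<open>u \<noteq> v\<close> makes the entries of a chain distinct, so that the geodesic meets
    \<open>S\<close> in \<open>k\<close> different vertices.\<close>
  define R where "R = (\<lambda>u v :: int \<times> int. u \<noteq> v \<and> fst u \<le> fst v \<and> snd u \<le> snd v)"
  define Q where "Q = (\<lambda>u v :: int \<times> int. u \<noteq> v \<and> fst u \<le> fst v \<and> snd v \<le> snd u)"
  have "transp R" "transp Q"
    by (auto simp: transp_def R_def Q_def prod_eq_iff)
  moreover have "R u v \<or> R v u \<or> Q u v \<or> Q v u" if "u \<noteq> v" for u v
    using that by (auto simp: R_def Q_def)
  ultimately obtain vs where vs: "length vs = k" "set vs \<subseteq> S" "sorted_wrt R vs \<or> sorted_wrt Q vs"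
    using long_chain_exists[OF fin, of k R Q] \<open>\<not> card S \<le> (k - 1)\<^sup>2\<close> by (metis not_le)
  have "monotone_points (map natural_labeling vs)"
    using vs(3)
  proof
    assume "sorted_wrt R vs"
    then have "sorted_wrt (\<lambda>u v. fst u \<le> fst v) vs" "sorted_wrt (\<lambda>u v. snd u \<le> snd v) vs"
      by (auto simp: R_def elim!: sorted_wrt_mono_rel[rotated])
    then show ?thesis
      by (simp add: monotone_points_def natural_labeling_def sorted_wrt_map case_prod_beta)
  next
    assume "sorted_wrt Q vs"
    then have "sorted_wrt (\<lambda>u v. fst u \<le> fst v) vs" "sorted_wrt (\<lambda>u v. snd v \<le> snd u) vs"
      by (auto simp: Q_def elim!: sorted_wrt_mono_rel[rotated])
    then show ?thesis
      by (simp add: monotone_points_def natural_labeling_def sorted_wrt_map case_prod_beta)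
  qed
  moreover have "set vs \<subseteq> pverts G"
    using vs(2) gp by (auto simp: gp_set_def)
  ultimately obtain g where g: "geodesic G g" "set vs \<subseteq> set g"
    using lab vs(1) unfolding monotone_geodesic_labeling_def by blast
  have "distinct vs"
    using vs(3) unfolding distinct_conv_nth R_def Q_def sorted_wrt_iff_nth_less
    by (metis linorder_neqE_nat)
  then have "card (set vs) = k"
    using vs(1) by (simp add: distinct_card)
  then have "k \<le> card (set g \<inter> S)"
    using g(2) vs(2) by (metis Int_greatest card_mono finite_Int finite_set)
  then show False
    using gp g(1) by (auto simp: gp_set_def)
qed

theorem theorem5p6:
  fixes G :: "(int \<times> int) pair_pre_digraph" and k :: nat
  assumes "grid_graph G"
    and "k \<ge> 2"
    and "contains_subgraph G (path_graph (2 * k - 3) \<box> path_graph (2 * k - 3))"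
    and "monotone_geodesic_labeling k G natural_labeling"
  shows "gp k G = enat ((k - 1)\<^sup>2)"
proof (rule antisym)
  interpret grid G
    using assms(1) by (rule grid_graph_imp_grid)
  obtain a b where "{a..<a + int (2 * k - 3)} \<times> {b..<b + int (2 * k - 3)} \<subseteq> pverts G"
    using grid_contains_box[OF grid_axioms assms(3)] .
  from gp_set_in_box[OF assms(2) this]
  obtain S where "gp_set k G S" "finite S" "card S = (k - 1)\<^sup>2" .
  then show "enat ((k - 1)\<^sup>2) \<le> gp k G"
    unfolding gp_def by (intro SUP_upper2[of S]) auto
  have "finite S \<and> card S \<le> (k - 1)\<^sup>2" if S: "gp_set k G S" for S
  proof -
    \<comment> \<open>An infinite set would contain a subset of size
      \<open>(k - 1)\<^sup>2 + 1\<close>, again in general position; so the value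
      \<open>\<infinity>\<close> does not enter the supremum.\<close>
    have "finite S"
    proof (rule ccontr)
      assume "infinite S"
      then obtain T where T: "T \<subseteq> S" "finite T" "card T = Suc ((k - 1)\<^sup>2)"
        using infinite_arbitrarily_large by metis
      have "gp_set k G T"
        unfolding gp_set_def
      proof (intro conjI notI)
        show "T \<subseteq> pverts G"
          using S T(1) by (auto simp: gp_set_def)
        assume "\<exists>p. geodesic G p \<and> k \<le> card (set p \<inter> T)"
        then obtain p where "geodesic G p" "k \<le> card (set p \<inter> T)"
          by blast
        moreover have "card (set p \<inter> T) \<le> card (set p \<inter> S)"
          using T(1) by (intro card_mono) auto
        ultimately show False
          using S by (auto simp: gp_set_def)
      qed
      then show False
        using card_gp_set_le[OF assms(4)] T by fastforce
    qed
    then show ?thesis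
      using card_gp_set_le[OF assms(4) S] by simp
  qed
  then show "gp k G \<le> enat ((k - 1)\<^sup>2)"
    unfolding gp_def by (intro SUP_least) auto
qed

end
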